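(* Let $(Q,\cdot,\backslash,/)$ be a middle Bol loop and let $g_1:Q^2\to Q$ be defined by $g_1(x,y)=(xy)\backslash x$ or $g_1(x,y)=x\backslash(x/y)$. Below each identity is required for all $x,y\in Q$. Consider the identities $$\begin{aligned} (A)&\quad (((xy)x)x)x=x(((yx)x)x), & (B)&\quad (((xy)x)x)x=x((yx)(xx)),\\ (C)&\quad (((xy)x)x)x=x((y(xx))x), & (D)&\quad (((xy)x)x)x=x(y((xx)x)),\\ (E)&\quad (((xy)x)x)x=x(y(x(xx))), & (D')&\quad (((xy)x)x)x=x(yx^3). \end{aligned}$$ 1. $(Q,\cdot)$ satisfies $(A)$ if and only if $g_1(x,y)=x\big[x\cdot\big(x\cdot g_1(x,((yx)x)x)\big)\big]$. 2. $(Q,\cdot)$ satisfies $(B)$ if and only if $g_1(x,y)=x\big[x\cdot\big(x\cdot g_1(x,(yx)(xx))\big)\big]$. 3. $(Q,\cdot)$ satisfies $(C)$ if and only if $g_1(x,y)=x\big[x\cdot\big(x\cdot g_1(x,(y(xx))x)\big)\big]$. 4. The following are equivalent: (a) $(Q,\cdot)$ satisfies $(D)$; (b) $(Q,\cdot)$ satisfies $(E)$; (c) $(Q,\cdot)$ satisfies $(D')$; (d) $g_1(x,y)=x\big[x\cdot\big(x\cdot g_1(x,yx^3)\big)\big]$. 5. If $(Q,\cdot)$ satisfies $(xy)y=x(yy)$, then the following are equivalent: $(Q,\cdot)$ satisfies $(A)$; $(Q,\cdot)$ satisfies $(B)$; $(Q,\cdot)$ satisfies $(C)$. 6. If $(Q,\cdot)$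 satisfies $(x(yy))y=x((yy)y)$, then the following are equivalent: $(Q,\cdot)$ satisfies $(C)$; $(Q,\cdot)$ satisfies $(D)$; $(Q,\cdot)$ satisfies $(E)$. 7. If $(Q,\cdot)$ satisfies $(xy)(yy)=x(y(yy))$, then the following are equivalent: $(Q,\cdot)$ satisfies $(B)$; $(Q,\cdot)$ satisfies $(C)$; $(Q,\cdot)$ satisfies $(D)$. 8. If $(Q,\cdot)$ satisfies $(xy)y=x(yy)$, $(x(yy))y=x((yy)y)$ and $(xy)(yy)=x(y(yy))$, then the following are equivalent: (a) $(Q,\cdot)$ satisfies $(A)$; (b) $(Q,\cdot)$ satisfies $(B)$; (c) $(Q,\cdot)$ satisfies $(C)$; (d) $(Q,\cdot)$ satisfies $(D)$; (e) $(Q,\cdot)$ satisfies $(E)$; (f) $(Q,\cdot)$ satisfies $(xy)x^3=x(yx^3)$. 9. $(Q,\cdot)$ satisfies $((((xy)x)x)x)x=x((((yx)x)x)x)$ if and only if $g_1(x,y)=x\cdot\Big(x\big[x\cdot\big(x\cdot g_1(x,(((yx)x)x)x)\big)\big]\Big)$.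
   Context: A loop $(Q,\cdot,\backslash,/)$ is a loop $(Q,\cdot)$ with identity $e$, where $x\backslash y$ is the unique $z$ with $x\cdot z=y$ and $x/y$ is the unique $z$ with $z\cdot y=x$. It is a middle Bol loop if $x((yz)\backslash x)=(x/z)(y\backslash x)$ for all $x,y,z$. In a middle Bol loop the two expressions given for $g_1$ agree. Middle Bol loops are power associative, so $x^3=(xx)x=x(xx)$ is unambiguous. *)

theory Defs
  imports Main
begin

text \<open>
  The underlying set of a loop is the whole type \<open>'a\<close>. The operations
  \<open>x \<setminus> y\<close> and \<open>x \<sslash> y\<close> denote left and right division.
\<close>

locale loop =
  fixes mult :: "'a \<Rightarrow> 'a \<Rightarrow> 'a" (infixl "\<cdot>" 70)
    and ldiv :: "'a \<Rightarrow> 'a \<Rightarrow> 'a" (infixl "\<setminus>" 70)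
    and rdiv :: "'a \<Rightarrow> 'a \<Rightarrow> 'a" (infixl "\<sslash>" 70)
    and e :: 'a
  assumes left_identity: "e \<cdot> x = x"
    and right_identity: "x \<cdot> e = x"
    and ldiv_unique: "x \<cdot> z = y \<longleftrightarrow> z = x \<setminus> y"
    and rdiv_unique: "z \<cdot> y = x \<longleftrightarrow> z = x \<sslash> y"

locale middle_bol_loop = loop +
  assumes middle_bol: "x \<cdot> ((y \<cdot> z) \<setminus> x) = (x \<sslash> z) \<cdot> (y \<setminus> x)"

text \<open>Middle Bol loops are power associative, so the bracketing chosen here is immaterial for them.\<close>

definition cube :: "('a \<Rightarrow> 'a \<Rightarrow> 'a) \<Rightarrow> 'a \<Rightarrow> 'a" where
  "cube mult x = (x \<cdot> x) \<cdot> x" for mult (infixl "\<cdot>" 70)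

definition identity_A :: "('a \<Rightarrow> 'a \<Rightarrow> 'a) \<Rightarrow> bool" where
  "identity_A mult \<longleftrightarrow> (\<forall>x y. (((x \<cdot> y) \<cdot> x) \<cdot> x) \<cdot> x = x \<cdot> (((y \<cdot> x) \<cdot> x) \<cdot> x))"
  for mult (infixl "\<cdot>" 70)

definition identity_B :: "('a \<Rightarrow> 'a \<Rightarrow> 'a) \<Rightarrow> bool" where
  "identity_B mult \<longleftrightarrow> (\<forall>x y. (((x \<cdot> y) \<cdot> x) \<cdot> x) \<cdot> x = x \<cdot> ((y \<cdot> x) \<cdot> (x \<cdot> x)))"
  for mult (infixl "\<cdot>" 70)

definition identity_C :: "('a \<Rightarrow> 'a \<Rightarrow> 'a) \<Rightarrow> bool" where
  "identity_C mult \<longleftrightarrow> (\<forall>x y. (((x \<cdot> y) \<cdot> x) \<cdot> x) \<cdot> x = x \<cdot> ((y \<cdot> (x \<cdot> x)) \<cdot> x))"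
  for mult (infixl "\<cdot>" 70)

definition identity_D :: "('a \<Rightarrow> 'a \<Rightarrow> 'a) \<Rightarrow> bool" where
  "identity_D mult \<longleftrightarrow> (\<forall>x y. (((x \<cdot> y) \<cdot> x) \<cdot> x) \<cdot> x = x \<cdot> (y \<cdot> ((x \<cdot> x) \<cdot> x)))"
  for mult (infixl "\<cdot>" 70)

definition identity_E :: "('a \<Rightarrow> 'a \<Rightarrow> 'a) \<Rightarrow> bool" where
  "identity_E mult \<longleftrightarrow> (\<forall>x y. (((x \<cdot> y) \<cdot> x) \<cdot> x) \<cdot> x = x \<cdot> (y \<cdot> (x \<cdot> (x \<cdot> x))))"
  for mult (infixl "\<cdot>" 70)

definition identity_D' :: "('a \<Rightarrow> 'a \<Rightarrow> 'a) \<Rightarrow> bool" where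
  "identity_D' mult \<longleftrightarrow> (\<forall>x y. (((x \<cdot> y) \<cdot> x) \<cdot> x) \<cdot> x = x \<cdot> (y \<cdot> cube mult x))"
  for mult (infixl "\<cdot>" 70)

end

theory Submission
  imports Defs
begin

text \<open>
  Right multiplication by \<open>x\<close> and division into \<open>x\<close> are linked by
  \<open>y \<setminus> x = x \<cdot> ((y \<cdot> x) \<setminus> x)\<close>. Iterating this rule (\<open>ldiv_step\<close>) rewrites \<open>(x \<cdot> y) \<setminus> x\<close> as
  \<open>x \<cdot> (x \<cdot> (x \<cdot> (w \<setminus> x)))\<close> with \<open>w = (((x \<cdot> y) \<cdot> x) \<cdot> x) \<cdot> x\<close>, and \<open>w \<setminus> x\<close> determines \<open>w\<close>. Hence
  every identity \<open>w = x \<cdot> v\<close> is a functional equation for \<open>g\<^sub>1\<close>. The parts on (D), (E), (D') need only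
  \<open>(x \<cdot> x) \<cdot> x = x \<cdot> (x \<cdot> x)\<close>, and all but one of the equivalences under extra laws come from
  rewriting the right-hand sides into each other.

  The exception is the equivalence of (B) and (C) under the law \<open>(x \<cdot> y) \<cdot> (y \<cdot> y) = x \<cdot> (y \<cdot> (y \<cdot> y))\<close>.
  Write \<open>R\<^sub>x\<close>, \<open>L\<^sub>x\<close> for the translations. The law says \<open>R\<^bsub>x\<cdot>x\<^esub> R\<^sub>x = R\<^bsub>x\<cdot>(x\<cdot>x)\<^esub>\<close>, and the difference between
  (B) and (C) is the order of \<open>R\<^sub>x\<close> and \<open>R\<^bsub>x\<cdot>x\<^esub>\<close>. Each of (B) and (C) turns out to force these two
  translations to commute. The argument uses the left Bol loop \<open>x \<star> y = x \<sslash> y\<^sup>\<ominus>\<close>, where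
  \<open>y\<^sup>\<ominus>\<close> is the inverse of \<open>y\<close>, and has two stages.

  Stage one. In terms of \<open>\<star>\<close> the law means that left translation by \<open>x \<cdot> x\<close> commutes with right
  translation by \<open>x\<close> (\<open>left_square_right_commute\<close>). A consequence is that squares satisfy
  \<open>y \<cdot> d = y \<star> d\<close>, that is, they have the right inverse property \<open>(y \<cdot> d) \<cdot> d\<^sup>\<ominus> = y\<close>. Evaluating (B) or
  (C) at one well-chosen argument built from such a \<open>d\<close> makes the two products agree on the other
  side as well, \<open>d \<cdot> w = d \<star> w\<close> (\<open>B_imp_rip_left\<close>, \<open>C_imp_rip_left\<close>).

  Stage two. Once the two products agree at squares on both sides, \<open>L\<^sub>x\<close> commutes with
  \<open>R\<^bsub>x\<cdot>x\<^esub>\<close>, and \<open>L\<^bsub>x\<cdot>x\<^esub>\<close> commutes with the right translations by \<open>x\<close> and \<open>x\<^sup>\<ominus>\<close>. Then (B) at \<open>x\<close> and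
  at \<open>x\<^sup>\<ominus>\<close>, together with their conjugates under \<open>y \<mapsto> x \<star> (y \<star> x)\<close>, become four
  relations between the permutations \<open>L\<^sub>x\<close>, \<open>R\<^sub>x\<close>, \<open>R\<^bsub>x\<cdot>x\<^esub>\<close> and \<open>R\<close> at \<open>x\<^sup>\<ominus>\<close>; these relations alone force
  \<open>R\<^sub>x\<close> and \<open>R\<^bsub>x\<cdot>x\<^esub>\<close> to commute (\<open>B_relations_commute\<close>, and \<open>C_relations_commute\<close> for (C)).
\<close>

section \<open>Inverses and the equations for \<open>g\<^sub>1\<close>\<close>

context loop
begin

lemma mult_ldiv [simp]: "x \<cdot> (x \<setminus> y) = y"
  using ldiv_unique by simp

lemma ldiv_mult [simp]: "x \<setminus> (x \<cdot> y) = y"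
  by (metis ldiv_unique)

lemma rdiv_mult [simp]: "(x \<sslash> y) \<cdot> y = x"
  using rdiv_unique by simp

lemma mult_rdiv [simp]: "(x \<cdot> y) \<sslash> y = x"
  by (metis rdiv_unique)

lemma mult_left_cancel [simp]: "x \<cdot> y = x \<cdot> z \<longleftrightarrow> y = z"
  by (metis ldiv_mult)

lemma mult_right_cancel [simp]: "y \<cdot> x = z \<cdot> x \<longleftrightarrow> y = z"
  by (metis mult_rdiv)

lemma ldiv_right_cancel [simp]: "y \<setminus> x = z \<setminus> x \<longleftrightarrow> y = z"
  by (metis ldiv_unique rdiv_unique)

lemma bij_left_mult: "bij ((\<cdot>) x)"
  by (rule bijI') (simp, metis mult_ldiv)

lemma bij_right_mult: "bij (\<lambda>y. y \<cdot> x)"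
  by (rule bijI') (simp, metis rdiv_mult)

definition right_inverse ("_\<^sup>\<ominus>" [1000] 1000) where
  "x\<^sup>\<ominus> = x \<setminus> e"

end

context middle_bol_loop
begin

lemma ldiv_step: "y \<setminus> x = x \<cdot> ((y \<cdot> x) \<setminus> x)"
  using middle_bol[of x y x] by (metis left_identity rdiv_unique)

lemma ldiv_eq_ldiv_rdiv: "(x \<cdot> y) \<setminus> x = x \<setminus> (x \<sslash> y)"
  by (metis ldiv_mult middle_bol ldiv_unique right_identity)

lemma ldiv_three_steps:
  "(((x \<cdot> y) \<cdot> x) \<cdot> x) \<cdot> x = x \<cdot> v \<longleftrightarrow> (x \<cdot> y) \<setminus> x = x \<cdot> (x \<cdot> (x \<cdot> ((x \<cdot> v) \<setminus> x)))"
  using ldiv_step[of "x \<cdot> y" x] ldiv_step[of "(x \<cdot> y) \<cdot> x" x] ldiv_step[of "((x \<cdot> y) \<cdot> x) \<cdot> x" x]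
  by simp

lemma ldiv_four_steps:
  "((((x \<cdot> y) \<cdot> x) \<cdot> x) \<cdot> x) \<cdot> x = x \<cdot> v \<longleftrightarrow> (x \<cdot> y) \<setminus> x = x \<cdot> (x \<cdot> (x \<cdot> (x \<cdot> ((x \<cdot> v) \<setminus> x))))"
  using ldiv_step[of "x \<cdot> y" x] ldiv_step[of "(x \<cdot> y) \<cdot> x" x] ldiv_step[of "((x \<cdot> y) \<cdot> x) \<cdot> x" x]
    ldiv_step[of "(((x \<cdot> y) \<cdot> x) \<cdot> x) \<cdot> x" x]
  by simp

lemma mult_inverse [simp]: "x \<cdot> x\<^sup>\<ominus> = e"
  by (simp add: right_inverse_def)

lemma inverse_eq_rdiv: "x\<^sup>\<ominus> = e \<sslash> x"
  by (metis right_inverse_def left_identity middle_bol ldiv_unique right_identity)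

lemma inverse_inverse [simp]: "x\<^sup>\<ominus>\<^sup>\<ominus> = x"
  by (metis inverse_eq_rdiv mult_inverse rdiv_unique)

lemma inverse_unique: "x \<cdot> y = e \<Longrightarrow> y = x\<^sup>\<ominus>"
  by (simp add: right_inverse_def ldiv_unique)

lemma inverse_of_mult: "(x \<cdot> y)\<^sup>\<ominus> = y\<^sup>\<ominus> \<cdot> x\<^sup>\<ominus>"
  by (metis right_inverse_def inverse_eq_rdiv left_identity middle_bol)

section \<open>The associated left Bol loop\<close>

text \<open>
  Middle Bol loops are the isostrophs of left Bol loops: in terms of this product right
  translations of \<open>\<cdot>\<close> become inverse right translations of \<open>\<star>\<close>, and the middle Bol identity becomes
  the left Bol identity \<open>left_bol\<close>, which is far easier to iterate.
\<close>
definition bol (infixl "\<star>" 70) where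
  "x \<star> y = x \<sslash> y\<^sup>\<ominus>"

lemma bol_mult_inverse [simp]: "(x \<star> y) \<cdot> y\<^sup>\<ominus> = x"
  by (simp add: bol_def)

lemma mult_bol_inverse [simp]: "(x \<cdot> y) \<star> y\<^sup>\<ominus> = x"
  by (simp add: bol_def)

lemma bol_inverse_mult [simp]: "(x \<star> y\<^sup>\<ominus>) \<cdot> y = x"
  by (simp add: bol_def)

lemma mult_inverse_bol [simp]: "(x \<cdot> y\<^sup>\<ominus>) \<star> y = x"
  by (simp add: bol_def)

lemma mult_eq_iff_bol: "x \<cdot> y = z \<longleftrightarrow> z \<star> y\<^sup>\<ominus> = x"
  by (metis bol_inverse_mult mult_bol_inverse)

lemma bol_e [simp]: "x \<star> e = x"
  by (metis bol_inverse_mult inverse_unique right_identity)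

lemma e_bol [simp]: "e \<star> x = x"
  by (metis bol_def inverse_inverse inverse_eq_rdiv)

lemma inverse_bol_cancel [simp]: "x\<^sup>\<ominus> \<star> (x \<star> y) = y"
  by (metis inverse_of_mult bol_mult_inverse inverse_inverse mult_bol_inverse)

lemma bol_inverse_cancel [simp]: "x \<star> (x\<^sup>\<ominus> \<star> y) = y"
  by (metis inverse_bol_cancel inverse_inverse)

lemma bol_inverse [simp]: "x \<star> x\<^sup>\<ominus> = e"
  by (metis bol_inverse_cancel bol_e)

lemma inverse_bol [simp]: "x\<^sup>\<ominus> \<star> x = e"
  by (metis inverse_bol_cancel bol_e)

lemma bol_left_cancel [simp]: "x \<star> y = x \<star> z \<longleftrightarrow> y = z"
  by (metis inverse_bol_cancel)

lemma bol_right_cancel [simp]: "y \<star> x = z \<star> x \<longleftrightarrow> y = z"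
  by (metis bol_mult_inverse)

lemma ldiv_eq_bol: "y \<setminus> x = (x\<^sup>\<ominus> \<star> y)\<^sup>\<ominus>"
  by (metis inverse_of_mult bol_mult_inverse inverse_inverse ldiv_unique)

lemma rdiv_eq_bol: "x \<sslash> y = x \<star> y\<^sup>\<ominus>"
  by (simp add: bol_def)

text \<open>
  The middle Bol identity in terms of \<open>\<star>\<close>, evaluated at a factorization \<open>u \<cdot> v\<close> of
  \<open>x \<star> (y \<star> x)\<close> with \<open>v = z\<^sup>\<ominus>\<close>, so that both divisions on its left-hand side cancel.
\<close>
lemma left_bol: "(x \<star> (y \<star> x)) \<star> z = x \<star> (y \<star> (x \<star> z))"
proof -
  define w where "w = y \<star> x"
  have "x \<cdot> (x\<^sup>\<ominus> \<star> (u \<cdot> v))\<^sup>\<ominus> = (x \<star> v\<^sup>\<ominus>) \<cdot> (x\<^sup>\<ominus> \<star> u)\<^sup>\<ominus>" for u v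
    using middle_bol[of x u v] by (simp add: ldiv_eq_bol rdiv_eq_bol)
  from this[of "(x \<star> w) \<star> z" "z\<^sup>\<ominus>"]
  have "x \<cdot> w\<^sup>\<ominus> = (x \<star> z) \<cdot> (x\<^sup>\<ominus> \<star> ((x \<star> w) \<star> z))\<^sup>\<ominus>"
    by simp
  moreover have "x \<cdot> w\<^sup>\<ominus> = y\<^sup>\<ominus>"
    by (metis w_def inverse_bol_cancel bol_mult_inverse)
  ultimately have "y\<^sup>\<ominus> \<star> (x\<^sup>\<ominus> \<star> ((x \<star> w) \<star> z)) = x \<star> z"
    by (metis mult_inverse_bol)
  then show ?thesis
    by (metis w_def bol_inverse_cancel inverse_inverse)
qed

lemma inverse_of_bol_bol: "(x \<star> (y \<star> x))\<^sup>\<ominus> = x\<^sup>\<ominus> \<star> (y\<^sup>\<ominus> \<star> x\<^sup>\<ominus>)"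
  by (metis left_bol bol_inverse inverse_bol_cancel)

lemma bol_bol_eq_mult: "c \<star> (y \<star> c) = (c \<star> y) \<cdot> c"
  by (metis bol_inverse bol_e left_bol bol_def rdiv_mult inverse_inverse)

lemma bol_square_bol: "(c \<star> c) \<star> y = c \<star> (c \<star> y)"
  using left_bol[of c e y] by simp

lemma bol_square: "c \<star> c = c \<cdot> c"
  using bol_bol_eq_mult[of c e] by simp

lemma square_mult_assoc: "(c \<cdot> c) \<cdot> c = c \<cdot> (c \<cdot> c)"
  by (metis inverse_of_mult bol_square inverse_of_bol_bol inverse_inverse bol_bol_eq_mult)

lemma inverse_of_square: "(c \<cdot> c)\<^sup>\<ominus> = c\<^sup>\<ominus> \<cdot> c\<^sup>\<ominus>"
  by (rule inverse_of_mult)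

text \<open>
  With \<open>P y = c \<star> (y \<star> c)\<close>, conjugation by \<open>P\<close> exchanges left translation by \<open>c\<close> with the inverse
  of left translation by \<open>c\<^sup>\<ominus>\<close>. It turns an identity at \<open>c\<close> into a genuinely new one at \<open>c\<^sup>\<ominus>\<close>.
\<close>
lemma P_left_mult: "c \<star> (y \<star> c) = c \<cdot> (c \<star> ((c\<^sup>\<ominus> \<cdot> y) \<star> c))"
proof -
  define w where "w = c\<^sup>\<ominus> \<cdot> y"
  have "w\<^sup>\<ominus> \<star> c\<^sup>\<ominus> = y\<^sup>\<ominus>"
    by (simp add: w_def inverse_of_mult)
  then have "(c \<star> (y \<star> c)) \<star> (c \<star> (w \<star> c))\<^sup>\<ominus> = c"
    by (simp add: left_bol inverse_of_bol_bol)
  then show ?thesis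
    by (metis mult_eq_iff_bol w_def)
qed

end

section \<open>The law \<open>(x \<cdot> y) \<cdot> (y \<cdot> y) = x \<cdot> (y \<cdot> (y \<cdot> y))\<close>\<close>

locale third_power_loop = middle_bol_loop +
  assumes third_power: "(x \<cdot> y) \<cdot> (y \<cdot> y) = x \<cdot> (y \<cdot> (y \<cdot> y))"
begin

lemma bol_third_power: "(y \<star> (c \<cdot> c)) \<star> c = y \<star> (c \<cdot> (c \<cdot> c))"
  by (metis inverse_of_mult mult_eq_iff_bol inverse_inverse square_mult_assoc third_power)

lemma P_bol_square: "c \<star> ((y \<star> (c \<cdot> c)) \<star> c) = (c \<star> (y \<star> c)) \<star> (c \<cdot> c)"
proof -
  have "c \<star> (y \<star> (c \<cdot> (c \<cdot> c))) = (c \<star> (y \<star> c)) \<star> (c \<cdot> c)"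
    using left_bol[of c y "c \<cdot> c"] by (metis bol_square bol_bol_eq_mult square_mult_assoc)
  then show ?thesis
    by (simp add: bol_third_power)
qed

text \<open>
  Let \<open>\<lambda>\<close>, \<open>\<rho>\<close>, \<open>\<rho>\<^sub>2\<close> be the translations of \<open>\<star>\<close> by \<open>c\<close> on the left, by \<open>c\<close> on the right and by
  \<open>c \<cdot> c\<close> on the right. The left Bol identity gives \<open>\<lambda> \<rho>\<^sub>2 = \<rho> \<lambda> \<rho>\<close> and the law makes \<open>\<lambda> \<rho>\<close> commute
  with \<open>\<rho>\<^sub>2\<close>, so \<open>\<lambda> \<lambda> \<rho> \<rho>\<^sub>2 = \<lambda> \<rho>\<^sub>2 \<lambda> \<rho> = \<rho> \<lambda> \<rho> \<lambda> \<rho> = \<rho> \<lambda> \<lambda> \<rho>\<^sub>2\<close>, and \<open>\<rho>\<^sub>2\<close> cancels.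
\<close>
lemma left_square_right_commute: "c \<star> (c \<star> (y \<star> c)) = (c \<star> (c \<star> y)) \<star> c"
proof -
  have "c \<star> (z \<star> (c \<cdot> c)) = (c \<star> (z \<star> c)) \<star> c" for z
    using left_bol[of c z c] by (simp add: bol_square)
  then have "c \<star> (c \<star> ((z \<star> (c \<cdot> c)) \<star> c)) = (c \<star> (c \<star> (z \<star> (c \<cdot> c)))) \<star> c" for z
    by (metis P_bol_square)
  from this[of "y \<cdot> (c \<cdot> c)\<^sup>\<ominus>"] show ?thesis
    by simp
qed

lemma bol_mult_flexible: "(c \<star> y) \<star> c = c \<star> (y \<cdot> c)"
  by (metis left_square_right_commute bol_inverse_cancel bol_bol_eq_mult)

lemma inverse_bol_bol: "c\<^sup>\<ominus> \<star> (y \<star> c) = (c\<^sup>\<ominus> \<star> y) \<cdot> c"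
  by (metis bol_mult_flexible inverse_bol_cancel bol_inverse_cancel)

lemma inverse_bol_mult: "(c\<^sup>\<ominus> \<star> y) \<star> c = c\<^sup>\<ominus> \<star> (y \<cdot> c)"
  by (metis bol_bol_eq_mult inverse_bol_cancel bol_inverse_cancel)

lemma bol_right_alternative: "y \<star> (c \<cdot> c) = (y \<star> c) \<cdot> c"
proof -
  have "c \<star> (y \<star> (c \<cdot> c)) = (c \<star> (y \<star> c)) \<star> c"
    using left_bol[of c y c] by (simp add: bol_square)
  then show ?thesis
    by (simp add: bol_mult_flexible)
qed

lemma mult_square_eq_bol: "y \<cdot> (c \<cdot> c) = y \<star> (c \<cdot> c)"
proof -
  have "(y \<star> (c \<cdot> c)) \<star> (c \<cdot> c)\<^sup>\<ominus> = y"
    by (simp add: inverse_of_square bol_right_alternative)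
  then show ?thesis
    by (simp add: mult_eq_iff_bol)
qed

text \<open>
  The law in the form \<open>(y \<star> (u \<cdot> u)) \<star> u\<^sup>\<ominus> = y \<star> u\<close>, at the element \<open>y\<close> whose left translation is
  the composite of those by \<open>c\<close>, \<open>(c \<star> u)\<^sup>\<ominus>\<close> and \<open>c\<close>. For this \<open>y\<close> the right-hand side is \<open>c\<close>.
\<close>
lemma bol_square_expand: "c \<star> (u \<cdot> u) = (c \<star> u) \<star> (c\<^sup>\<ominus> \<star> (c \<cdot> u))"
proof -
  define y where "y = c \<star> ((c \<star> u)\<^sup>\<ominus> \<star> c)"
  have y: "y \<star> z = c \<star> ((c \<star> u)\<^sup>\<ominus> \<star> (c \<star> z))" for z
    unfolding y_def by (rule left_bol)
  have "(y \<star> (u \<cdot> u)) \<star> u\<^sup>\<ominus> = c"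
    using y[of u] by (simp add: bol_right_alternative)
  then have "c \<cdot> u = c \<star> ((c \<star> u)\<^sup>\<ominus> \<star> (c \<star> (u \<cdot> u)))"
    by (simp add: mult_eq_iff_bol y)
  then show ?thesis
    by simp
qed

lemma bol_eq_mult_if_alternative: "(c \<star> u) \<star> u = c \<star> (u \<cdot> u) \<Longrightarrow> c \<star> u = c \<cdot> u"
  by (metis bol_square_expand bol_inverse_cancel bol_left_cancel)

lemma inverse_bol_square: "(c\<^sup>\<ominus> \<star> y) \<star> (c \<cdot> c) = c\<^sup>\<ominus> \<star> ((y \<cdot> c) \<star> c)"
  by (simp add: bol_right_alternative inverse_bol_mult inverse_bol_bol)

section \<open>Elements with the right inverse property\<close>

context
  fixes d
  assumes rip: "\<And>y. y \<cdot> d = y \<star> d"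
begin

lemma rip_inverse: "y \<cdot> d\<^sup>\<ominus> = y \<star> d\<^sup>\<ominus>"
  by (metis rip bol_mult_inverse mult_bol_inverse bol_inverse_mult)

text \<open>
  The inverse of \<open>v = (d \<cdot> x) \<star> (x \<cdot> x)\<close> can be computed: the law gives \<open>v = d \<cdot> (x \<cdot> (x \<cdot> x))\<close>, and
  inverting reverses the order, which moves \<open>d\<close> to the side where the two products agree.
\<close>
lemma rip_square: "x\<^sup>\<ominus> \<star> ((d \<cdot> x) \<star> x) = x\<^sup>\<ominus> \<cdot> (d \<star> (x \<cdot> x))"
proof -
  define v where "v = (d \<cdot> x) \<star> (x \<cdot> x)"
  have "v = d \<cdot> (x \<cdot> (x \<cdot> x))"
    by (metis mult_square_eq_bol third_power v_def)
  then have "v\<^sup>\<ominus> = (x \<cdot> (x \<cdot> x))\<^sup>\<ominus> \<star> d\<^sup>\<ominus>"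
    by (simp add: inverse_of_mult rip_inverse)
  also have "\<dots> = x\<^sup>\<ominus> \<star> (x\<^sup>\<ominus> \<star> (x\<^sup>\<ominus> \<star> d\<^sup>\<ominus>))"
    by (metis inverse_of_mult bol_square left_bol bol_bol_eq_mult)
  finally have "x \<star> v\<^sup>\<ominus> = (x \<cdot> x)\<^sup>\<ominus> \<star> d\<^sup>\<ominus>"
    by (metis bol_inverse_cancel bol_square bol_square_bol inverse_of_square)
  also have "\<dots> = (d \<star> (x \<cdot> x))\<^sup>\<ominus>"
    by (metis inverse_of_mult rip_inverse mult_square_eq_bol)
  finally have v: "x\<^sup>\<ominus> \<star> (d \<star> (x \<cdot> x))\<^sup>\<ominus> = v\<^sup>\<ominus>"
    by (metis inverse_bol_cancel)
  have "(d \<cdot> x) \<star> x = v \<star> x\<^sup>\<ominus>"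
    by (simp add: v_def bol_right_alternative)
  then have "(x\<^sup>\<ominus> \<star> ((d \<cdot> x) \<star> x)) \<star> (d \<star> (x \<cdot> x))\<^sup>\<ominus> = x\<^sup>\<ominus>"
    by (simp add: left_bol v)
  then show ?thesis
    by (metis mult_eq_iff_bol)
qed

lemma rip_shift: "(x\<^sup>\<ominus> \<cdot> (d \<cdot> x\<^sup>\<ominus>)) \<star> x = x\<^sup>\<ominus> \<star> d"
proof -
  have "x\<^sup>\<ominus> \<star> (x \<cdot> d\<^sup>\<ominus>) = d\<^sup>\<ominus>"
    by (simp add: rip_inverse)
  then have "(x\<^sup>\<ominus> \<star> (d \<star> x\<^sup>\<ominus>)) \<star> (d \<cdot> x\<^sup>\<ominus>)\<^sup>\<ominus> = x\<^sup>\<ominus>"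
    by (simp add: left_bol inverse_of_mult)
  then have "x\<^sup>\<ominus> \<cdot> (d \<cdot> x\<^sup>\<ominus>) = x\<^sup>\<ominus> \<star> (d \<star> x\<^sup>\<ominus>)"
    by (simp add: mult_eq_iff_bol)
  then show ?thesis
    by (simp add: bol_bol_eq_mult)
qed

end

text \<open>
  Conjugating (B) at \<open>c\<close> by \<open>P y = c \<star> (y \<star> c)\<close>: right translations are transported by
  \<open>bol_bol_eq_mult\<close> and \<open>P_bol_square\<close>, left translations by \<open>P_left_mult\<close>.
\<close>
lemma B_conjugate:
  assumes B: "\<And>x y. (((x \<cdot> y) \<cdot> x) \<cdot> x) \<cdot> x = x \<cdot> ((y \<cdot> x) \<cdot> (x \<cdot> x))"
  shows "c\<^sup>\<ominus> \<cdot> (((y \<star> c) \<star> c) \<star> c) = ((c\<^sup>\<ominus> \<cdot> y) \<star> c) \<star> (c \<cdot> c)"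
proof -
  define w where "w = c\<^sup>\<ominus> \<cdot> y"
  have "c \<star> ((((y \<star> c) \<star> c) \<star> c) \<star> c) = (((c \<star> (y \<star> c)) \<cdot> c) \<cdot> c) \<cdot> c"
    by (simp add: bol_bol_eq_mult)
  also have "\<dots> = (((c \<cdot> (c \<star> (w \<star> c))) \<cdot> c) \<cdot> c) \<cdot> c"
    by (metis P_left_mult w_def)
  also have "\<dots> = c \<cdot> (((c \<star> (w \<star> c)) \<cdot> c) \<cdot> (c \<cdot> c))"
    by (rule B)
  also have "\<dots> = c \<cdot> (c \<star> (((w \<star> c) \<star> (c \<cdot> c)) \<star> c))"
    by (metis P_bol_square mult_square_eq_bol bol_bol_eq_mult)
  finally have "c \<star> ((c\<^sup>\<ominus> \<cdot> (((y \<star> c) \<star> c) \<star> c)) \<star> c) = c \<star> (((w \<star> c) \<star> (c \<cdot> c)) \<star> c)"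
    by (metis P_left_mult mult_left_cancel)
  then show ?thesis
    by (simp add: w_def)
qed

lemma C_conjugate:
  assumes C: "\<And>x y. (((x \<cdot> y) \<cdot> x) \<cdot> x) \<cdot> x = x \<cdot> ((y \<cdot> (x \<cdot> x)) \<cdot> x)"
  shows "c\<^sup>\<ominus> \<cdot> (((y \<star> c) \<star> c) \<star> c) = ((c\<^sup>\<ominus> \<cdot> y) \<star> (c \<cdot> c)) \<star> c"
proof -
  define w where "w = c\<^sup>\<ominus> \<cdot> y"
  have "c \<star> ((((y \<star> c) \<star> c) \<star> c) \<star> c) = (((c \<star> (y \<star> c)) \<cdot> c) \<cdot> c) \<cdot> c"
    by (simp add: bol_bol_eq_mult)
  also have "\<dots> = (((c \<cdot> (c \<star> (w \<star> c))) \<cdot> c) \<cdot> c) \<cdot> c"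
    by (metis P_left_mult w_def)
  also have "\<dots> = c \<cdot> (((c \<star> (w \<star> c)) \<cdot> (c \<cdot> c)) \<cdot> c)"
    by (rule C)
  also have "\<dots> = c \<cdot> (c \<star> (((w \<star> (c \<cdot> c)) \<star> c) \<star> c))"
    by (metis P_bol_square mult_square_eq_bol bol_bol_eq_mult)
  finally have "c \<star> ((c\<^sup>\<ominus> \<cdot> (((y \<star> c) \<star> c) \<star> c)) \<star> c) = c \<star> (((w \<star> (c \<cdot> c)) \<star> c) \<star> c)"
    by (metis P_left_mult mult_left_cancel)
  then show ?thesis
    by (simp add: w_def)
qed

text \<open>
  The argument \<open>y = d \<cdot> x\<^sup>\<ominus>\<close> of the conjugated identity satisfies \<open>y \<star> x = d\<close>. Both sides can then be
  evaluated, and comparison with \<open>rip_square\<close> leaves \<open>(d \<star> x) \<star> x = d \<star> (x \<cdot> x)\<close>.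
\<close>
lemma B_imp_rip_left:
  assumes B: "\<And>x y. (((x \<cdot> y) \<cdot> x) \<cdot> x) \<cdot> x = x \<cdot> ((y \<cdot> x) \<cdot> (x \<cdot> x))"
    and rip: "\<And>y. y \<cdot> d = y \<star> d"
  shows "d \<cdot> x = d \<star> x"
proof -
  have "x\<^sup>\<ominus> \<cdot> ((d \<star> x) \<star> x) = (x\<^sup>\<ominus> \<star> d) \<star> (x \<cdot> x)"
    using B_conjugate[OF B, of x "d \<cdot> x\<^sup>\<ominus>"] rip_shift[OF rip] by simp
  also have "\<dots> = x\<^sup>\<ominus> \<cdot> (d \<star> (x \<cdot> x))"
    by (simp add: inverse_bol_square rip_square[OF rip])
  finally show ?thesis
    by (metis mult_left_cancel bol_eq_mult_if_alternative)
qed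

text \<open>
  For (C) the identity at \<open>x\<^sup>\<ominus>\<close> itself serves, with the same argument \<open>d \<cdot> x\<^sup>\<ominus>\<close>. It yields the
  alternative law first at \<open>x\<^sup>\<ominus> \<star> d\<close> in place of \<open>d\<close>.
\<close>
lemma C_imp_rip_left:
  assumes C: "\<And>x y. (((x \<cdot> y) \<cdot> x) \<cdot> x) \<cdot> x = x \<cdot> ((y \<cdot> (x \<cdot> x)) \<cdot> x)"
    and rip: "\<And>y. y \<cdot> d = y \<star> d"
  shows "d \<cdot> x = d \<star> x"
proof -
  have "x\<^sup>\<ominus> \<cdot> ((y \<star> x) \<star> (x \<cdot> x)) = (((x\<^sup>\<ominus> \<cdot> y) \<star> x) \<star> x) \<star> x" for y
    using C[of "x\<^sup>\<ominus>" "(y \<star> x) \<star> (x \<cdot> x)"]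
    by (simp add: inverse_of_square[symmetric] mult_eq_iff_bol)
  from this[of "d \<cdot> x\<^sup>\<ominus>"] have "((x\<^sup>\<ominus> \<star> d) \<star> x) \<star> x = x\<^sup>\<ominus> \<cdot> (d \<star> (x \<cdot> x))"
    using rip_shift[OF rip] by simp
  also have "\<dots> = (x\<^sup>\<ominus> \<star> d) \<star> (x \<cdot> x)"
    by (simp add: inverse_bol_square rip_square[OF rip])
  finally have "(x\<^sup>\<ominus> \<star> d) \<star> x = (x\<^sup>\<ominus> \<star> d) \<cdot> x"
    by (rule bol_eq_mult_if_alternative)
  then show ?thesis
    by (metis inverse_bol_bol inverse_bol_mult bol_left_cancel)
qed

end

section \<open>Four relations that force two permutations to commute\<close>

text \<open>
  Below \<open>a\<close>, \<open>b\<close>, \<open>t\<close>, \<open>u\<close> are to be read as the translations \<open>L\<^sub>x\<close>, \<open>R\<^sub>x\<close>, \<open>R\<^bsub>x\<cdot>x\<^esub>\<close> and \<open>R\<close> at \<open>x\<^sup>\<ominus>\<close>.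
  Eliminating \<open>a\<close> from the first two relations gives \<open>b b b = t t t u u u\<close>, hence
  \<open>u t u t = t t u u\<close>; the last two give \<open>t t u = u t t\<close>. Together \<open>u t u t = u t t u\<close>, so \<open>u t = t u\<close>.
\<close>
lemma B_relations_commute:
  fixes a b t u :: "'b \<Rightarrow> 'b"
  assumes bij: "bij a" "bij t" "bij u"
    and b: "\<And>y. b y = t (u y)"
    and at: "\<And>y. a (t y) = t (a y)"
    and r1: "\<And>y. b (b (b (a y))) = t (a (b y))"
    and r2: "\<And>y. t (u (u (u (a y)))) = a (u y)"
    and r3: "\<And>y. a (b (b (b y))) = b (t (a y))"
    and r4: "\<And>y. a (u (u (u (t y)))) = u (a y)"
  shows "t (u y) = u (t y)"
proof -
  have t: "t y = t z \<longleftrightarrow> y = z" and u: "u y = u z \<longleftrightarrow> y = z" for y z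
    using bij by (simp_all add: bij_is_inj inj_eq)
  have surj: "\<exists>z. a z = y" "\<exists>z. u z = y" for y
    using bij(1,3)[THEN bij_is_surj] by (metis surjD)+
  have "b (b (b (a y))) = t (t (t (u (u (u (a y))))))" for y
    unfolding r1 by (simp add: b at r2)
  then have bbb: "b (b (b y)) = t (t (t (u (u (u y)))))" for y
    using surj(1)[of y] by auto
  have "u (t (u (t (u y)))) = t (t (u (u (u y))))" for y
    using bbb[of y] by (simp add: b t)
  then have utut: "u (t (u (t y))) = t (t (u (u y)))" for y
    using surj(2)[of y] by auto
  have "t (t (a (u (u (u (t y)))))) = u (t (a (t y)))" for y
    using r3[of "t y"] unfolding bbb by (simp add: at b t)
  then have "t (t (u (a y))) = u (t (t (a y)))" for y
    by (simp add: r4 at)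
  then have "t (t (u y)) = u (t (t y))" for y
    using surj(1)[of y] by auto
  then have "u (t (u (t y))) = u (t (t (u y)))"
    using utut[of y] by metis
  then show ?thesis
    by (simp add: t u)
qed

text \<open>
  The same elimination for (C): the first two relations give \<open>t u t u = u u t t\<close> and the last two
  \<open>u t t = t t u\<close>, hence \<open>t u t u = u t t u\<close>.
\<close>
lemma C_relations_commute:
  fixes a b t u :: "'b \<Rightarrow> 'b"
  assumes bij: "bij a" "bij t" "bij u"
    and b: "\<And>y. b y = t (u y)"
    and at: "\<And>y. a (t y) = t (a y)"
    and r1: "\<And>y. b (b (b (a y))) = a (b (t y))"
    and r2: "\<And>y. u (u (u (a (t y)))) = a (u y)"
    and r3: "\<And>y. a (b (b (b y))) = t (b (a y))"
    and r4: "\<And>y. t (a (u (u (u y)))) = u (a y)"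
  shows "t (u y) = u (t y)"
proof -
  have t: "t y = t z \<longleftrightarrow> y = z" and u: "u y = u z \<longleftrightarrow> y = z" for y z
    using bij by (simp_all add: bij_is_inj inj_eq)
  have surj: "\<exists>z. a z = y" "\<exists>z. u z = y" "\<exists>z. t z = y" for y
    using bij[THEN bij_is_surj] by (metis surjD)+
  have "a (u y) = u (u (u (t (a y))))" for y
    using r2[of y] by (simp add: at)
  then have "b (b (b (a y))) = t (u (u (u (t (t (a y))))))" for y
    unfolding r1 by (simp add: b at)
  then have bbb: "b (b (b y)) = t (u (u (u (t (t y)))))" for y
    using surj(1)[of y] by auto
  have tutu: "t (u (t (u y))) = u (u (t (t y)))" for y
    using bbb[of y] by (simp add: b t u)
  have "t (a (u (u (u (t (t y)))))) = t (t (u (a y)))" for y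
    using r3[of y] unfolding bbb by (simp add: at b)
  then have "u (t (t (a y))) = t (t (u (a y)))" for y
    by (simp add: r4 at)
  then have utt: "u (t (t y)) = t (t (u y))" for y
    using surj(1)[of y] by auto
  have "t (u (t (u y))) = u (t (t (u y)))" for y
    by (simp only: tutu utt)
  then have "t (u (t y)) = u (t (t y))" for y
    using surj(2)[of y] by auto
  then show ?thesis
    using surj(3)[of y] by auto
qed

section \<open>Commuting translations\<close>

context third_power_loop
begin

lemma mult_square_cancel: "(y \<cdot> (x\<^sup>\<ominus> \<cdot> x\<^sup>\<ominus>)) \<cdot> (x \<cdot> x) = y"
  by (metis bol_mult_inverse inverse_inverse inverse_of_square mult_square_eq_bol)

lemma mult_square_cancel': "(y \<cdot> (x \<cdot> x)) \<cdot> (x\<^sup>\<ominus> \<cdot> x\<^sup>\<ominus>) = y"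
  by (metis mult_square_cancel inverse_inverse)

lemma mult_inverse_square: "(y \<cdot> x\<^sup>\<ominus>) \<cdot> (x \<cdot> x) = y \<cdot> x"
  by (simp add: mult_square_eq_bol bol_right_alternative)

context
  assumes square_left: "\<And>z w. (z \<cdot> z) \<cdot> w = (z \<cdot> z) \<star> w"
begin

lemma square_right_commute: "(x \<cdot> x) \<cdot> (y \<cdot> x) = ((x \<cdot> x) \<cdot> y) \<cdot> x"
  by (metis square_left bol_square bol_square_bol bol_bol_eq_mult bol_mult_flexible)

lemma square_inverse_commute: "(x \<cdot> x) \<cdot> (y \<cdot> x\<^sup>\<ominus>) = ((x \<cdot> x) \<cdot> y) \<cdot> x\<^sup>\<ominus>"
proof -
  have "(x \<cdot> x) \<star> ((y \<cdot> x\<^sup>\<ominus>) \<star> x) = ((x \<cdot> x) \<star> (y \<cdot> x\<^sup>\<ominus>)) \<star> x"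
    by (metis bol_square bol_square_bol left_square_right_commute)
  then show ?thesis
    by (simp add: square_left mult_eq_iff_bol)
qed

lemma square_inverse_square_commute:
  "(x \<cdot> x) \<cdot> (y \<cdot> (x\<^sup>\<ominus> \<cdot> x\<^sup>\<ominus>)) = ((x \<cdot> x) \<cdot> y) \<cdot> (x\<^sup>\<ominus> \<cdot> x\<^sup>\<ominus>)"
  by (metis mult_inverse_square inverse_inverse square_inverse_commute square_right_commute rdiv_mult)

lemma left_square_commute: "x \<cdot> (y \<cdot> (x \<cdot> x)) = (x \<cdot> y) \<cdot> (x \<cdot> x)"
  by (metis inverse_of_mult inverse_inverse inverse_of_square square_right_commute)

lemma square_inverse_mult: "(x \<cdot> x) \<cdot> (x\<^sup>\<ominus> \<cdot> y) = x \<cdot> y"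
  by (metis inverse_of_mult inverse_inverse inverse_of_square mult_inverse_square)

text \<open>
  The four relations are (B) at \<open>x\<close>, (B) at \<open>x\<^sup>\<ominus>\<close>, and the conjugates of (B) at \<open>x\<^sup>\<ominus>\<close> and at \<open>x\<close>. In
  the second and the fourth, left multiplication by \<open>x \<cdot> x\<close> turns the left translation by \<open>x\<^sup>\<ominus>\<close>
  into the one by \<open>x\<close>.
\<close>
lemma B_imp_commute:
  assumes B: "\<And>x y. (((x \<cdot> y) \<cdot> x) \<cdot> x) \<cdot> x = x \<cdot> ((y \<cdot> x) \<cdot> (x \<cdot> x))"
  shows "(y \<cdot> x\<^sup>\<ominus>) \<cdot> (x \<cdot> x) = (y \<cdot> (x \<cdot> x)) \<cdot> x\<^sup>\<ominus>"
proof (rule B_relations_commute[where a = "(\<cdot>) x" and b = "\<lambda>y. y \<cdot> x" and t = "\<lambda>y. y \<cdot> (x \<cdot> x)"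
      and u = "\<lambda>y. y \<cdot> x\<^sup>\<ominus>"])
  fix z
  show "x \<cdot> z \<cdot> x \<cdot> x \<cdot> x = x \<cdot> (z \<cdot> x) \<cdot> (x \<cdot> x)"
    by (simp add: B left_square_commute)
  have "((x \<cdot> z \<cdot> x\<^sup>\<ominus>) \<cdot> x\<^sup>\<ominus>) \<cdot> x\<^sup>\<ominus> = x \<cdot> ((z \<cdot> x\<^sup>\<ominus>) \<cdot> (x\<^sup>\<ominus> \<cdot> x\<^sup>\<ominus>))"
    using arg_cong[OF B[of "x\<^sup>\<ominus>" z], of "(\<cdot>) (x \<cdot> x)"]
    by (simp add: square_inverse_commute square_inverse_mult)
  then show "x \<cdot> z \<cdot> x\<^sup>\<ominus> \<cdot> x\<^sup>\<ominus> \<cdot> x\<^sup>\<ominus> \<cdot> (x \<cdot> x) = x \<cdot> (z \<cdot> x\<^sup>\<ominus>)"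
    by (metis left_square_commute mult_square_cancel)
  have "(x \<cdot> (z \<cdot> x \<cdot> x \<cdot> x) \<star> x\<^sup>\<ominus>) \<star> (x \<cdot> x)\<^sup>\<ominus> = x \<cdot> z"
    using B_conjugate[OF B, of "x\<^sup>\<ominus>" "z \<cdot> x \<cdot> x \<cdot> x"] by (simp add: inverse_of_square)
  then show "x \<cdot> (z \<cdot> x \<cdot> x \<cdot> x) = x \<cdot> z \<cdot> (x \<cdot> x) \<cdot> x"
    by (metis mult_eq_iff_bol)
  have "x\<^sup>\<ominus> \<cdot> w = (x\<^sup>\<ominus> \<cdot> (w \<cdot> x\<^sup>\<ominus> \<cdot> x\<^sup>\<ominus> \<cdot> x\<^sup>\<ominus>) \<star> x) \<star> (x \<cdot> x)" for w
    using B_conjugate[OF B, of x "w \<cdot> x\<^sup>\<ominus> \<cdot> x\<^sup>\<ominus> \<cdot> x\<^sup>\<ominus>"] by simp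
  then have "x\<^sup>\<ominus> \<cdot> (w \<cdot> x\<^sup>\<ominus> \<cdot> x\<^sup>\<ominus> \<cdot> x\<^sup>\<ominus>) = ((x\<^sup>\<ominus> \<cdot> w) \<cdot> (x\<^sup>\<ominus> \<cdot> x\<^sup>\<ominus>)) \<cdot> x\<^sup>\<ominus>" for w
    by (metis bol_mult_inverse inverse_of_square)
  from arg_cong[OF this, of "(\<cdot>) (x \<cdot> x)"]
  have "x \<cdot> (w \<cdot> x\<^sup>\<ominus> \<cdot> x\<^sup>\<ominus> \<cdot> x\<^sup>\<ominus>) = ((x \<cdot> w) \<cdot> (x\<^sup>\<ominus> \<cdot> x\<^sup>\<ominus>)) \<cdot> x\<^sup>\<ominus>" for w
    by (simp add: square_inverse_commute square_inverse_square_commute square_inverse_mult)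
  then show "x \<cdot> (z \<cdot> (x \<cdot> x) \<cdot> x\<^sup>\<ominus> \<cdot> x\<^sup>\<ominus> \<cdot> x\<^sup>\<ominus>) = x \<cdot> z \<cdot> x\<^sup>\<ominus>"
    by (simp add: left_square_commute mult_square_cancel')
qed (simp_all add: bij_left_mult bij_right_mult mult_inverse_square left_square_commute)

lemma C_imp_commute:
  assumes C: "\<And>x y. (((x \<cdot> y) \<cdot> x) \<cdot> x) \<cdot> x = x \<cdot> ((y \<cdot> (x \<cdot> x)) \<cdot> x)"
  shows "(y \<cdot> x\<^sup>\<ominus>) \<cdot> (x \<cdot> x) = (y \<cdot> (x \<cdot> x)) \<cdot> x\<^sup>\<ominus>"
proof (rule C_relations_commute[where a = "(\<cdot>) x" and b = "\<lambda>y. y \<cdot> x" and t = "\<lambda>y. y \<cdot> (x \<cdot> x)"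
      and u = "\<lambda>y. y \<cdot> x\<^sup>\<ominus>"])
  fix z
  show "x \<cdot> z \<cdot> x \<cdot> x \<cdot> x = x \<cdot> (z \<cdot> (x \<cdot> x) \<cdot> x)"
    by (rule C)
  have "((x \<cdot> w \<cdot> x\<^sup>\<ominus>) \<cdot> x\<^sup>\<ominus>) \<cdot> x\<^sup>\<ominus> = x \<cdot> ((w \<cdot> (x\<^sup>\<ominus> \<cdot> x\<^sup>\<ominus>)) \<cdot> x\<^sup>\<ominus>)" for w
    using arg_cong[OF C[of "x\<^sup>\<ominus>" w], of "(\<cdot>) (x \<cdot> x)"]
    by (simp add: square_inverse_commute square_inverse_mult)
  then show "x \<cdot> (z \<cdot> (x \<cdot> x)) \<cdot> x\<^sup>\<ominus> \<cdot> x\<^sup>\<ominus> \<cdot> x\<^sup>\<ominus> = x \<cdot> (z \<cdot> x\<^sup>\<ominus>)"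
    by (simp add: mult_square_cancel')
  have "(x \<cdot> (z \<cdot> x \<cdot> x \<cdot> x) \<star> (x \<cdot> x)\<^sup>\<ominus>) \<star> x\<^sup>\<ominus> = x \<cdot> z"
    using C_conjugate[OF C, of "x\<^sup>\<ominus>" "z \<cdot> x \<cdot> x \<cdot> x"] by (simp add: inverse_of_square)
  then show "x \<cdot> (z \<cdot> x \<cdot> x \<cdot> x) = x \<cdot> z \<cdot> x \<cdot> (x \<cdot> x)"
    by (metis mult_eq_iff_bol)
  have "x\<^sup>\<ominus> \<cdot> z = (x\<^sup>\<ominus> \<cdot> (z \<cdot> x\<^sup>\<ominus> \<cdot> x\<^sup>\<ominus> \<cdot> x\<^sup>\<ominus>) \<star> (x \<cdot> x)) \<star> x"
    using C_conjugate[OF C, of x "z \<cdot> x\<^sup>\<ominus> \<cdot> x\<^sup>\<ominus> \<cdot> x\<^sup>\<ominus>"] by simp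
  then have "x\<^sup>\<ominus> \<cdot> (z \<cdot> x\<^sup>\<ominus> \<cdot> x\<^sup>\<ominus> \<cdot> x\<^sup>\<ominus>) = ((x\<^sup>\<ominus> \<cdot> z) \<cdot> x\<^sup>\<ominus>) \<cdot> (x\<^sup>\<ominus> \<cdot> x\<^sup>\<ominus>)"
    by (metis bol_mult_inverse inverse_of_square)
  from arg_cong[OF this, of "(\<cdot>) (x \<cdot> x)"]
  have "x \<cdot> (z \<cdot> x\<^sup>\<ominus> \<cdot> x\<^sup>\<ominus> \<cdot> x\<^sup>\<ominus>) = ((x \<cdot> z) \<cdot> x\<^sup>\<ominus>) \<cdot> (x\<^sup>\<ominus> \<cdot> x\<^sup>\<ominus>)"
    by (simp add: square_inverse_commute square_inverse_square_commute square_inverse_mult)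
  then show "x \<cdot> (z \<cdot> x\<^sup>\<ominus> \<cdot> x\<^sup>\<ominus> \<cdot> x\<^sup>\<ominus>) \<cdot> (x \<cdot> x) = x \<cdot> z \<cdot> x\<^sup>\<ominus>"
    by (simp add: mult_square_cancel)
qed (simp_all add: bij_left_mult bij_right_mult mult_inverse_square left_square_commute)

end

text \<open>
  The translation by \<open>x\<close> is the composite of those by \<open>x\<^sup>\<ominus>\<close> and \<open>x \<cdot> x\<close> (\<open>mult_inverse_square\<close>), so it
  commutes with the latter as soon as the translation by \<open>x\<^sup>\<ominus>\<close> does.
\<close>
lemma square_commute_right:
  assumes "\<And>y. (y \<cdot> x\<^sup>\<ominus>) \<cdot> (x \<cdot> x) = (y \<cdot> (x \<cdot> x)) \<cdot> x\<^sup>\<ominus>"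
  shows "(y \<cdot> x) \<cdot> (x \<cdot> x) = (y \<cdot> (x \<cdot> x)) \<cdot> x"
  using assms[of y] assms[of "y \<cdot> (x \<cdot> x)"] by (simp add: mult_square_eq_bol bol_right_alternative)

theorem B_iff_C: "identity_B (\<cdot>) \<longleftrightarrow> identity_C (\<cdot>)"
proof -
  have "(y \<cdot> x) \<cdot> (x \<cdot> x) = (y \<cdot> (x \<cdot> x)) \<cdot> x" if "identity_B (\<cdot>) \<or> identity_C (\<cdot>)" for x y
    using that
  proof
    assume "identity_B (\<cdot>)"
    then have B: "(((x \<cdot> y) \<cdot> x) \<cdot> x) \<cdot> x = x \<cdot> ((y \<cdot> x) \<cdot> (x \<cdot> x))" for x y
      by (simp add: identity_B_def)
    have "(z \<cdot> z) \<cdot> w = (z \<cdot> z) \<star> w" for z w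
      by (rule B_imp_rip_left[OF B mult_square_eq_bol])
    then show ?thesis
      by (rule square_commute_right[OF B_imp_commute[OF _ B]])
  next
    assume "identity_C (\<cdot>)"
    then have C: "(((x \<cdot> y) \<cdot> x) \<cdot> x) \<cdot> x = x \<cdot> ((y \<cdot> (x \<cdot> x)) \<cdot> x)" for x y
      by (simp add: identity_C_def)
    have "(z \<cdot> z) \<cdot> w = (z \<cdot> z) \<star> w" for z w
      by (rule C_imp_rip_left[OF C mult_square_eq_bol])
    then show ?thesis
      by (rule square_commute_right[OF C_imp_commute[OF _ C]])
  qed
  then show ?thesis
    by (auto simp: identity_B_def identity_C_def)
qed

end

section \<open>Characterizations and equivalences\<close>

theorem theorem2p6:
  fixes mult :: "'a \<Rightarrow> 'a \<Rightarrow> 'a" (infixl "\<cdot>" 70)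
    and ldiv :: "'a \<Rightarrow> 'a \<Rightarrow> 'a" (infixl "\<setminus>" 70)
    and rdiv :: "'a \<Rightarrow> 'a \<Rightarrow> 'a" (infixl "\<sslash>" 70)
    and e :: 'a
    and g\<^sub>1 :: "'a \<Rightarrow> 'a \<Rightarrow> 'a"
  assumes "middle_bol_loop mult ldiv rdiv e"
    and "(\<forall>x y. g\<^sub>1 x y = (x \<cdot> y) \<setminus> x) \<or> (\<forall>x y. g\<^sub>1 x y = x \<setminus> (x \<sslash> y))"
  shows
    "(identity_A mult \<longleftrightarrow>
        (\<forall>x y. g\<^sub>1 x y = x \<cdot> (x \<cdot> (x \<cdot> g\<^sub>1 x (((y \<cdot> x) \<cdot> x) \<cdot> x)))))
   \<and> (identity_B mult \<longleftrightarrow>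
        (\<forall>x y. g\<^sub>1 x y = x \<cdot> (x \<cdot> (x \<cdot> g\<^sub>1 x ((y \<cdot> x) \<cdot> (x \<cdot> x))))))
   \<and> (identity_C mult \<longleftrightarrow>
        (\<forall>x y. g\<^sub>1 x y = x \<cdot> (x \<cdot> (x \<cdot> g\<^sub>1 x ((y \<cdot> (x \<cdot> x)) \<cdot> x)))))
   \<and> ((identity_D mult \<longleftrightarrow> identity_E mult)
        \<and> (identity_E mult \<longleftrightarrow> identity_D' mult)
        \<and> (identity_D' mult \<longleftrightarrow>
            (\<forall>x y. g\<^sub>1 x y = x \<cdot> (x \<cdot> (x \<cdot> g\<^sub>1 x (y \<cdot> cube mult x))))))
   \<and> ((\<forall>x y. (x \<cdot> y) \<cdot> y = x \<cdot> (y \<cdot> y)) \<longrightarrow>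
        (identity_A mult \<longleftrightarrow> identity_B mult) \<and> (identity_B mult \<longleftrightarrow> identity_C mult))
   \<and> ((\<forall>x y. (x \<cdot> (y \<cdot> y)) \<cdot> y = x \<cdot> ((y \<cdot> y) \<cdot> y)) \<longrightarrow>
        (identity_C mult \<longleftrightarrow> identity_D mult) \<and> (identity_D mult \<longleftrightarrow> identity_E mult))
   \<and> ((\<forall>x y. (x \<cdot> y) \<cdot> (y \<cdot> y) = x \<cdot> (y \<cdot> (y \<cdot> y))) \<longrightarrow>
        (identity_B mult \<longleftrightarrow> identity_C mult) \<and> (identity_C mult \<longleftrightarrow> identity_D mult))
   \<and> ((\<forall>x y. (x \<cdot> y) \<cdot> y = x \<cdot> (y \<cdot> y))
        \<and> (\<forall>x y. (x \<cdot> (y \<cdot> y)) \<cdot> y = x \<cdot> ((y \<cdot> y) \<cdot> y))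
        \<and> (\<forall>x y. (x \<cdot> y) \<cdot> (y \<cdot> y) = x \<cdot> (y \<cdot> (y \<cdot> y))) \<longrightarrow>
        (identity_A mult \<longleftrightarrow> identity_B mult)
        \<and> (identity_B mult \<longleftrightarrow> identity_C mult)
        \<and> (identity_C mult \<longleftrightarrow> identity_D mult)
        \<and> (identity_D mult \<longleftrightarrow> identity_E mult)
        \<and> (identity_E mult \<longleftrightarrow>
            (\<forall>x y. (x \<cdot> y) \<cdot> cube mult x = x \<cdot> (y \<cdot> cube mult x))))
   \<and> ((\<forall>x y. ((((x \<cdot> y) \<cdot> x) \<cdot> x) \<cdot> x) \<cdot> x = x \<cdot> ((((y \<cdot> x) \<cdot> x) \<cdot> x) \<cdot> x)) \<longleftrightarrow>
        (\<forall>x y. g\<^sub>1 x y = x \<cdot> (x \<cdot> (x \<cdot> (x \<cdot> g\<^sub>1 x ((((y \<cdot> x) \<cdot> x) \<cdot> x) \<cdot> x))))))"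
proof -
  interpret middle_bol_loop mult ldiv rdiv e
    by (rule assms(1))
  have g: "g\<^sub>1 x y = (x \<cdot> y) \<setminus> x" for x y
    using assms(2) by (auto simp: ldiv_eq_ldiv_rdiv)
  have A: "identity_A mult \<longleftrightarrow> (\<forall>x y. g\<^sub>1 x y = x \<cdot> (x \<cdot> (x \<cdot> g\<^sub>1 x (((y \<cdot> x) \<cdot> x) \<cdot> x))))"
    by (simp add: identity_A_def g flip: ldiv_three_steps)
  have B: "identity_B mult \<longleftrightarrow> (\<forall>x y. g\<^sub>1 x y = x \<cdot> (x \<cdot> (x \<cdot> g\<^sub>1 x ((y \<cdot> x) \<cdot> (x \<cdot> x)))))"
    by (simp add: identity_B_def g flip: ldiv_three_steps)
  have C: "identity_C mult \<longleftrightarrow> (\<forall>x y. g\<^sub>1 x y = x \<cdot> (x \<cdot> (x \<cdot> g\<^sub>1 x ((y \<cdot> (x \<cdot> x)) \<cdot> x))))"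
    by (simp add: identity_C_def g flip: ldiv_three_steps)
  have D': "identity_D' mult \<longleftrightarrow> (\<forall>x y. g\<^sub>1 x y = x \<cdot> (x \<cdot> (x \<cdot> g\<^sub>1 x (y \<cdot> cube mult x))))"
    by (simp add: identity_D'_def g flip: ldiv_three_steps)
  have DE: "identity_D mult \<longleftrightarrow> identity_E mult"
    by (simp add: identity_D_def identity_E_def square_mult_assoc)
  have ED': "identity_E mult \<longleftrightarrow> identity_D' mult"
    by (simp add: identity_D'_def identity_E_def square_mult_assoc cube_def)
  have four: "(\<forall>x y. ((((x \<cdot> y) \<cdot> x) \<cdot> x) \<cdot> x) \<cdot> x = x \<cdot> ((((y \<cdot> x) \<cdot> x) \<cdot> x) \<cdot> x)) \<longleftrightarrow>
      (\<forall>x y. g\<^sub>1 x y = x \<cdot> (x \<cdot> (x \<cdot> (x \<cdot> g\<^sub>1 x ((((y \<cdot> x) \<cdot> x) \<cdot> x) \<cdot> x)))))"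
    by (simp add: g flip: ldiv_four_steps)
  have AB: "identity_A mult \<longleftrightarrow> identity_B mult" and BC: "identity_B mult \<longleftrightarrow> identity_C mult"
    if "\<forall>x y. (x \<cdot> y) \<cdot> y = x \<cdot> (y \<cdot> y)"
    using that[rule_format, symmetric] by (simp_all add: identity_A_def identity_B_def identity_C_def)
  have CD: "identity_C mult \<longleftrightarrow> identity_D mult"
    if "\<forall>x y. (x \<cdot> (y \<cdot> y)) \<cdot> y = x \<cdot> ((y \<cdot> y) \<cdot> y)"
    using that by (simp add: identity_C_def identity_D_def)
  have BC': "identity_B mult \<longleftrightarrow> identity_C mult" and CD': "identity_C mult \<longleftrightarrow> identity_D mult"
    if law: "\<forall>x y. (x \<cdot> y) \<cdot> (y \<cdot> y) = x \<cdot> (y \<cdot> (y \<cdot> y))"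
  proof -
    interpret third_power_loop mult ldiv rdiv e
      by unfold_locales (simp add: law)
    show "identity_B mult \<longleftrightarrow> identity_C mult"
      by (rule B_iff_C)
    show "identity_C mult \<longleftrightarrow> identity_D mult"
      unfolding B_iff_C[symmetric]
      by (simp add: identity_B_def identity_D_def law square_mult_assoc)
  qed
  have EF: "identity_E mult \<longleftrightarrow> (\<forall>x y. (x \<cdot> y) \<cdot> cube mult x = x \<cdot> (y \<cdot> cube mult x))"
    if "\<forall>x y. (x \<cdot> y) \<cdot> y = x \<cdot> (y \<cdot> y)" and "\<forall>x y. (x \<cdot> (y \<cdot> y)) \<cdot> y = x \<cdot> ((y \<cdot> y) \<cdot> y)"
    using that by (simp add: identity_E_def cube_def square_mult_assoc)
  show ?thesis
    by (intro conjI impI; (elim conjE)?; rule A B C D' DE ED' four AB BC BC' CD CD' EF; assumption)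
qed

end
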